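(* Let $z^{\ast}$ be the optimal value of the master problem (MP), let $z^{u}$ be the optimal value of the restricted master problem (RMP) for a set $\tilde{\mathcal{Q}}\subseteq\mathcal{Q}$ of observed independent sets, and let $z^{l}=z^{u}+\kappa c_{r}^{\ast}$ be the associated column-generation lower bound on $z^{\ast}$ (all as defined in the context). Let $0\leq\epsilon<1$. If $z^{u}/z^{l}\leq 1+\epsilon$, then the optimal value of the RMP satisfies $z^{u}\leq(1+\epsilon)z^{\ast}$.
   Context: Setting. A visible light communication (VLC) network has finite sets of access points $\mathcal{V}$, user terminals $\mathcal{M}$ and channels $\mathcal{W}$; access point $i$ has a finite set $Tx_i$ of transmitters and user terminal $j$ has a finite set $Rx_j$ of receivers. A link is a tuple (access point $i$, transmitter $m\in Tx_i$, user terminal $j$, receiver $n\in Rx_j$, channel $b$) and has a fixed capacity $\mathcal{C}_{ij,mn}^{b}$. A conflict graph has the links as vertices, with an edge between two links that interfere with each other. An independent set is a set of links no two of which are adjacent in the conflict graph. Let $\mathcal{Q}=\{\mathcal{I}_1,\dots,\mathcal{I}_{|\mathcal{Q}|}\}$ be the finite set of all (admissible) independent sets, and let $x_{ij,mn}^{q,b}\in\{0,1\}$ equal $1$ if and only if the corresponding link belongs to $\mathcal{I}_q$. Data. To each $\mathcal{I}_q$ is attached a fixed total power consumption $p_q=P_{AC,Avg}(\mathcal{I}_q)+P_{DC}(\mathcal{I}_q)$, where $P_{AC,Avg}(\mathcal{I}_q)$ is the power used for communication when the links of $\mathcal{I}_q$ are active, and $P_{DC}(\mathcal{I}_q)$ is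 the optimal (minimal) additional illumination power for which the per-transmitter maximum power limits and the illuminance bounds at all positions are satisfied. The rate delivered to user terminal $j$ by $\mathcal{I}_q$ is $$a_{jq}=\sum_{i\in\mathcal{V}}\sum_{b\in\mathcal{W}}\sum_{m\in Tx_i}\sum_{n\in Rx_j}\mathcal{C}_{ij,mn}^{b}x_{ij,mn}^{q,b}.$$ User terminal $j$ has throughput requirement $\mathcal{R}_j$, and $P_{illumi}^{min}$ is the minimum total power consumption when all access points perform illumination only. Master problem (MP): minimize over $(\omega_q)_{1\le q\le|\mathcal{Q}|}$ $$\sum_{1\le q\le|\mathcal{Q}|}\omega_q p_q+\Big(1-\sum_{1\le q\le|\mathcal{Q}|}\omega_q\Big)P_{illumi}^{min}$$ subject to $\sum_{q}\omega_q a_{jq}\ge\mathcal{R}_j$ for all $j\in\mathcal{M}$, $\sum_q\omega_q\le 1$, and $\omega_q\ge 0$ for all $q$. Its optimal value is $z^{\ast}$. Restricted master problem (RMP): the same linear program with $\mathcal{Q}$ replaced by a subset $\tilde{\mathcal{Q}}\subseteq\mathcal{Q}$ (the "observed" independent sets). Its optimal value is $z^{u}$, an upper bound on $z^{\ast}$. Let $\lambda_j$ ($j\in\mathcal{M}$) be the optimal Lagrangian dual variables of the throughput constraints in the RMP. Reduced cost and lower bound. The reduced cost of an independent set $\mathcal{I}_q\in\mathcal{Q}\setminus\tilde{\mathcal{Q}}$ is $p_q-\sum_{j\in\mathcal{M}}\lambda_j a_{jq}-P_{illumi}^{min}$, and $c_r^{\ast}$ denotes the most negative reduced cost, i.e.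 the minimum of the reduced cost over $\mathcal{Q}\setminus\tilde{\mathcal{Q}}$ (the optimal value of the pricing problem). The number $\kappa$ is a constant such that $\kappa\ge\sum_{1\le q\le|\mathcal{Q}|}\omega_q$ holds for the optimal solution of the MP (e.g. $\kappa=1$). It is taken as a known fact of column generation, part of the setting, that $z^{u}+\kappa c_r^{\ast}\le z^{\ast}\le z^{u}$; one sets $z^{l}=z^{u}+\kappa c_r^{\ast}$ as the lower bound on $z^{\ast}$. When $z^{u}\le(1+\epsilon)z^{\ast}$, $z^{u}$ is called an $\epsilon$-bounded solution of the MP.
   Formalization: The formal theorem additionally assumes that the lower bound z^l is positive; for negative z^l the ratio condition z^u/z^l ≤ 1+ε holds vacuously and the claim can fail, and for z^l = 0 the ratio is undefined. *)

theory Defs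
  imports Complex_Main
begin

text \<open>A link is a tuple (access point, transmitter, user terminal, receiver, channel).\<close>

type_synonym ('ap, 'tx, 'ut, 'rx, 'ch) link = "'ap \<times> 'tx \<times> 'ut \<times> 'rx \<times> 'ch"

text \<open>
  In the fields below, \<open>ac_power N I i m\<close> is the average communication power of transmitter
  \<open>m\<close> of access point \<open>i\<close> while exactly the links in \<open>I\<close> are active, and
  \<open>illuminance N I d s\<close> is the illuminance at position \<open>s\<close> when in addition
  each transmitter \<open>(i, m)\<close> spends illumination power \<open>d i m\<close>. No particular
  channel or illumination model is fixed.
\<close>

record ('ap, 'tx, 'ut, 'rx, 'ch, 'pos) vlc_network =
  access_points :: "'ap set"
  terminals :: "'ut set"
  channels :: "'ch set"
  Tx :: "'ap \<Rightarrow> 'tx set"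
  Rx :: "'ut \<Rightarrow> 'rx set"
  capacity :: "('ap, 'tx, 'ut, 'rx, 'ch) link \<Rightarrow> real"
  interferes :: "('ap, 'tx, 'ut, 'rx, 'ch) link \<Rightarrow> ('ap, 'tx, 'ut, 'rx, 'ch) link \<Rightarrow> bool"
  requirement :: "'ut \<Rightarrow> real"
  ac_power :: "('ap, 'tx, 'ut, 'rx, 'ch) link set \<Rightarrow> 'ap \<Rightarrow> 'tx \<Rightarrow> real"
  max_power :: "'ap \<Rightarrow> 'tx \<Rightarrow> real"
  positions :: "'pos set"
  illuminance :: "('ap, 'tx, 'ut, 'rx, 'ch) link set \<Rightarrow> ('ap \<Rightarrow> 'tx \<Rightarrow> real) \<Rightarrow> 'pos \<Rightarrow> real"
  illuminance_min :: "'pos \<Rightarrow> real"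
  illuminance_max :: "'pos \<Rightarrow> real"

definition links ::
  "('ap, 'tx, 'ut, 'rx, 'ch, 'pos) vlc_network \<Rightarrow> ('ap, 'tx, 'ut, 'rx, 'ch) link set" where
  "links N = {(i, m, j, n, b). i \<in> access_points N \<and> m \<in> Tx N i \<and> j \<in> terminals N
                \<and> n \<in> Rx N j \<and> b \<in> channels N}"

text \<open>Adjacency in the conflict graph; symmetrised, so that interference may be
  specified in one direction only.\<close>

definition conflict_adj where
  "conflict_adj N l l' \<longleftrightarrow> l \<in> links N \<and> l' \<in> links N \<and> l \<noteq> l'
                           \<and> (interferes N l l' \<or> interferes N l' l)"

definition independent_set where
  "independent_set N I \<longleftrightarrow> I \<subseteq> links N \<and> (\<forall>l\<in>I. \<forall>l'\<in>I. \<not> conflict_adj N l l')"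

definition illumination_allocations ::
  "('ap, 'tx, 'ut, 'rx, 'ch, 'pos) vlc_network \<Rightarrow> ('ap, 'tx, 'ut, 'rx, 'ch) link set
     \<Rightarrow> ('ap \<Rightarrow> 'tx \<Rightarrow> real) set" where
  "illumination_allocations N I =
     {d. (\<forall>i\<in>access_points N. \<forall>m\<in>Tx N i. 0 \<le> d i m \<and> ac_power N I i m + d i m \<le> max_power N i m)
       \<and> (\<forall>s\<in>positions N. illuminance_min N s \<le> illuminance N I d s
                          \<and> illuminance N I d s \<le> illuminance_max N s)}"

definition P_AC where
  "P_AC N I = (\<Sum>i\<in>access_points N. \<Sum>m\<in>Tx N i. ac_power N I i m)"

definition P_DC where
  "P_DC N I = (INF d \<in> illumination_allocations N I. \<Sum>i\<in>access_points N. \<Sum>m\<in>Tx N i. d i m)"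

definition total_power where
  "total_power N I = P_AC N I + P_DC N I"

text \<open>Illumination only means that no link is active.\<close>

definition P_illumi_min where
  "P_illumi_min N = total_power N {}"

text \<open>An independent set is admissible if the illumination problem defining its
  power consumption is feasible.\<close>

definition admissible_sets ::
  "('ap, 'tx, 'ut, 'rx, 'ch, 'pos) vlc_network \<Rightarrow> ('ap, 'tx, 'ut, 'rx, 'ch) link set set" where
  "admissible_sets N = {I. independent_set N I \<and> illumination_allocations N I \<noteq> {}}"

definition valid_network :: "('ap, 'tx, 'ut, 'rx, 'ch, 'pos) vlc_network \<Rightarrow> bool" where
  "valid_network N \<longleftrightarrow>
     finite (access_points N) \<and> finite (terminals N) \<and> finite (channels N)
     \<and> (\<forall>i\<in>access_points N. finite (Tx N i))
     \<and> (\<forall>j\<in>terminals N. finite (Rx N j))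
     \<and> (\<forall>I\<in>admissible_sets N. \<forall>i\<in>access_points N. \<forall>m\<in>Tx N i. 0 \<le> ac_power N I i m)
     \<and> (\<forall>i\<in>access_points N. \<forall>m\<in>Tx N i. ac_power N {} i m = 0)
     \<and> illumination_allocations N {} \<noteq> {}"

text \<open>The factor \<open>of_bool (\<dots> \<in> I)\<close> is the 0/1 incidence variable of the link
  in \<open>I\<close>.\<close>

definition rate where
  "rate N j I = (\<Sum>i\<in>access_points N. \<Sum>b\<in>channels N. \<Sum>m\<in>Tx N i. \<Sum>n\<in>Rx N j.
                   capacity N (i, m, j, n, b) * of_bool ((i, m, j, n, b) \<in> I))"

text \<open>
  The master problem is the linear program below with \<open>S = admissible_sets N\<close>, the
  restricted one has \<open>S\<close> the observed sets. The weights are indexed by the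
  independent sets themselves; only their values on \<open>S\<close> matter.
\<close>

definition objective where
  "objective N S \<omega> = (\<Sum>I\<in>S. \<omega> I * total_power N I) + (1 - (\<Sum>I\<in>S. \<omega> I)) * P_illumi_min N"

definition time_shares :: "'a set \<Rightarrow> ('a \<Rightarrow> real) set" where
  "time_shares S = {\<omega>. (\<forall>I\<in>S. 0 \<le> \<omega> I) \<and> (\<Sum>I\<in>S. \<omega> I) \<le> 1}"

definition feasible_solutions where
  "feasible_solutions N S =
     {\<omega> \<in> time_shares S. \<forall>j\<in>terminals N. (\<Sum>I\<in>S. \<omega> I * rate N j I) \<ge> requirement N j}"

definition optimal_solution where
  "optimal_solution N S \<omega> \<longleftrightarrow> \<omega> \<in> feasible_solutions N S
     \<and> (\<forall>\<omega>'\<in>feasible_solutions N S. objective N S \<omega> \<le> objective N S \<omega>')"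

definition optimal_value where
  "optimal_value N S = (INF \<omega> \<in> feasible_solutions N S. objective N S \<omega>)"

text \<open>Lagrangian dual obtained by relaxing the throughput constraints; the constraints of
  \<^const>\<open>time_shares\<close> are kept, so the infimum is over a compact set in the
  coordinates \<open>S\<close>.\<close>

definition lagrangian where
  "lagrangian N S lam \<omega> =
     objective N S \<omega> + (\<Sum>j\<in>terminals N. lam j * (requirement N j - (\<Sum>I\<in>S. \<omega> I * rate N j I)))"

definition dual_function where
  "dual_function N S lam = (INF \<omega> \<in> time_shares S. lagrangian N S lam \<omega>)"

definition optimal_dual where
  "optimal_dual N S lam \<longleftrightarrow> (\<forall>j\<in>terminals N. 0 \<le> lam j)
     \<and> (\<forall>lam'. (\<forall>j\<in>terminals N. 0 \<le> lam' j) \<longrightarrow> dual_function N S lam' \<le> dual_function N S lam)"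

definition reduced_cost where
  "reduced_cost N lam I = total_power N I - (\<Sum>j\<in>terminals N. lam j * rate N j I) - P_illumi_min N"

text \<open>Unspecified when every admissible set has been observed.\<close>

definition min_reduced_cost where
  "min_reduced_cost N S lam = Min (reduced_cost N lam ` (admissible_sets N - S))"

definition lower_bound where
  "lower_bound N S lam \<kappa> = optimal_value N S + \<kappa> * min_reduced_cost N S lam"

end

theory Submission
  imports Defs
begin

text \<open>
  The bound \<open>z_l \<le> z_star\<close> comes from LP duality: Farkas' lemma yields multipliers whose
  Lagrangian is at least \<open>z_u\<close> on all time shares of the observed sets, so the optimal
  multipliers have this property too. Evaluating that Lagrangian at the restriction of an optimal
  solution of the master problem leaves only the unobserved sets, each of which contributes its
  weight times a reduced cost that is at least the minimal one. A positive minimal reduced cost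
  could make \<open>z_l\<close> exceed \<open>z_star\<close>, but then \<open>z_u = z_star\<close>, and
  the claim follows because powers are nonnegative.
\<close>

section \<open>Farkas' lemma and linear programming duality\<close>

text \<open>The induction step projects along a point \<open>y\<close> witnessing that the new constraint
  \<open>k\<close> is not redundant, as in Bartl's algebraic proof.\<close>

lemma farkas:
  fixes A :: "'i \<Rightarrow> 'v \<Rightarrow> real"
  assumes "finite I" and V: "finite V"
    and "\<And>x. (\<forall>i\<in>I. (\<Sum>v\<in>V. A i v * x v) \<le> 0) \<Longrightarrow> (\<Sum>v\<in>V. b v * x v) \<le> 0"
  shows "\<exists>c. (\<forall>i\<in>I. 0 \<le> c i) \<and> (\<forall>v\<in>V. b v = (\<Sum>i\<in>I. c i * A i v))"
  using assms(1,3)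
proof (induction I arbitrary: A b rule: finite_induct)
  case empty
  \<comment> \<open>Without constraints, \<open>x = b\<close> is an allowed test point, which forces
    \<open>b\<close> to vanish on \<open>V\<close>.\<close>
  have "(\<Sum>v\<in>V. b v * b v) \<le> 0"
    by (rule empty) simp
  then have "(\<Sum>v\<in>V. b v * b v) = 0"
    by (simp add: antisym sum_nonneg)
  then show ?case
    using V by (simp add: sum_nonneg_eq_0_iff)
next
  case (insert k I)
  show ?case
  proof (cases "\<forall>x. (\<forall>i\<in>I. (\<Sum>v\<in>V. A i v * x v) \<le> 0) \<longrightarrow> (\<Sum>v\<in>V. b v * x v) \<le> 0")
    case True
    with insert.IH[of A b] obtain c where
      c: "\<forall>i\<in>I. 0 \<le> c i" "\<forall>v\<in>V. b v = (\<Sum>i\<in>I. c i * A i v)"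
      by blast
    have "(\<Sum>i\<in>I. (c(k := 0)) i * A i v) = (\<Sum>i\<in>I. c i * A i v)" for v
      using insert.hyps by (intro sum.cong) auto
    with c insert.hyps show ?thesis
      by (intro exI[of _ "c(k := 0)"]) simp
  next
    case False
    then obtain y0 where
      y0: "\<forall>i\<in>I. (\<Sum>v\<in>V. A i v * y0 v) \<le> 0" "(\<Sum>v\<in>V. b v * y0 v) > 0"
      by (auto simp: not_le)
    \<comment> \<open>\<open>y0\<close> meets the constraints in \<open>I\<close> but violates the
      conclusion, so it must violate constraint \<open>k\<close>. Dividing by \<open>s\<close>
      normalises that violation to 1.\<close>
    define s where "s = (\<Sum>v\<in>V. A k v * y0 v)"
    have s: "s > 0"
      using insert.prems[of y0] y0 unfolding s_def by force
    define y where "y v = y0 v / s" for v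
    have y_eq: "(\<Sum>v\<in>V. a v * y v) = (\<Sum>v\<in>V. a v * y0 v) / s" for a
      by (simp add: y_def sum_divide_distrib)
    have yk: "(\<Sum>v\<in>V. A k v * y v) = 1"
      using s by (simp only: y_eq flip: s_def) simp
    have yi: "(\<Sum>v\<in>V. A i v * y v) \<le> 0" if "i \<in> I" for i
      using y0 s that by (simp add: y_eq divide_nonpos_pos)
    have yb: "(\<Sum>v\<in>V. b v * y v) > 0"
      using y0 s by (simp add: y_eq)
    \<comment> \<open>As a functional, \<open>proj a\<close> is \<open>a\<close> composed with the
      projection along \<open>y\<close> onto the kernel of \<open>A k\<close>.\<close>
    define proj where "proj a v = a v - (\<Sum>w\<in>V. a w * y w) * A k v" for a v
    have proj_eq: "(\<Sum>v\<in>V. proj a v * x v)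
        = (\<Sum>v\<in>V. a v * (x v - (\<Sum>w\<in>V. A k w * x w) * y v))" for a x
      by (simp add: proj_def algebra_simps sum_subtractf sum_distrib_left sum_distrib_right)
        (subst sum.swap, simp add: mult_ac)
    have "(\<Sum>v\<in>V. proj b v * x v) \<le> 0"
      if x: "\<forall>i\<in>I. (\<Sum>v\<in>V. proj (A i) v * x v) \<le> 0" for x
    proof -
      \<comment> \<open>The projected point meets constraint \<open>k\<close> with equality, so the
        original implication applies to it.\<close>
      have "proj (A k) v = 0" for v
        using yk by (simp add: proj_def)
      then show ?thesis
        using x insert.prems[of "\<lambda>v. x v - (\<Sum>w\<in>V. A k w * x w) * y v"]
        by (simp add: proj_eq[symmetric])
    qed
    then obtain c where c: "\<forall>i\<in>I. 0 \<le> c i"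
      "\<forall>v\<in>V. proj b v = (\<Sum>i\<in>I. c i * proj (A i) v)"
      using insert.IH[of "\<lambda>i. proj (A i)" "proj b"] by blast
    \<comment> \<open>Undoing the projection in the identity for \<open>proj b\<close> leaves
      exactly this coefficient on \<open>A k\<close>.\<close>
    define ck where "ck = (\<Sum>v\<in>V. b v * y v) - (\<Sum>i\<in>I. c i * (\<Sum>v\<in>V. A i v * y v))"
    have "(\<Sum>i\<in>I. c i * (\<Sum>v\<in>V. A i v * y v)) \<le> 0"
      using c yi by (intro sum_nonpos) (simp add: mult_nonneg_nonpos)
    with yb have ck: "ck \<ge> 0"
      by (simp add: ck_def)
    have b: "b v = ck * A k v + (\<Sum>i\<in>I. c i * A i v)" if "v \<in> V" for v
    proof -
      have "b v = (\<Sum>w\<in>V. b w * y w) * A k v + (\<Sum>i\<in>I. c i * proj (A i) v)"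
        using bspec[OF c(2) that] unfolding proj_def[of b] by linarith
      also have "(\<Sum>i\<in>I. c i * proj (A i) v)
          = (\<Sum>i\<in>I. c i * A i v) - (\<Sum>i\<in>I. c i * (\<Sum>v\<in>V. A i v * y v)) * A k v"
        by (simp add: proj_def right_diff_distrib sum_subtractf sum_distrib_right mult.assoc)
      finally show ?thesis
        by (simp add: ck_def algebra_simps)
    qed
    have "(\<Sum>i\<in>I. (c(k := ck)) i * A i v) = (\<Sum>i\<in>I. c i * A i v)" for v
      using insert.hyps by (intro sum.cong) auto
    with b c ck insert.hyps show ?thesis
      by (intro exI[of _ "c(k := ck)"]) auto
  qed
qed

text \<open>Sign constraints are extra rows \<open>- x u \<le> 0\<close>. Their nonnegative
  multipliers act as slack, which weakens the equality of \<open>farkas\<close> to an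
  inequality.\<close>

lemma farkas_nonneg:
  fixes A :: "'i \<Rightarrow> 'v \<Rightarrow> real"
  assumes I: "finite I" and V: "finite V"
    and imp: "\<And>x. \<lbrakk>\<forall>v\<in>V. 0 \<le> x v; \<forall>i\<in>I. (\<Sum>v\<in>V. A i v * x v) \<le> 0\<rbrakk>
      \<Longrightarrow> (\<Sum>v\<in>V. b v * x v) \<le> 0"
  shows "\<exists>c. (\<forall>i\<in>I. 0 \<le> c i) \<and> (\<forall>v\<in>V. b v \<le> (\<Sum>i\<in>I. c i * A i v))"
proof -
  define B where "B = case_sum A (\<lambda>u v. - of_bool (u = v) :: real)"
  have "(\<Sum>v\<in>V. b v * x v) \<le> 0"
    if x: "\<forall>k\<in>I <+> V. (\<Sum>v\<in>V. B k v * x v) \<le> 0" for x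
  proof (rule imp)
    show "\<forall>v\<in>V. 0 \<le> x v"
    proof
      fix u assume u: "u \<in> V"
      then have "(\<Sum>v\<in>V. B (Inr u) v * x v) \<le> 0"
        using x by blast
      moreover have "(\<Sum>v\<in>V. B (Inr u) v * x v) = (\<Sum>v\<in>V. if u = v then - x v else 0)"
        by (intro sum.cong) (auto simp: B_def)
      ultimately show "0 \<le> x u"
        using u V by simp
    qed
    show "\<forall>i\<in>I. (\<Sum>v\<in>V. A i v * x v) \<le> 0"
      using x by (force simp: B_def dest: bspec[OF _ InlI])
  qed
  then obtain c where c: "\<forall>k\<in>I <+> V. 0 \<le> c k"
    "\<forall>v\<in>V. b v = (\<Sum>k\<in>I <+> V. c k * B k v)"
    using farkas[of "I <+> V" V B b] I V by auto
  have "b v \<le> (\<Sum>i\<in>I. c (Inl i) * A i v)" if "v \<in> V" for v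
  proof -
    have "b v = (\<Sum>i\<in>I. c (Inl i) * A i v) + (\<Sum>u\<in>V. c (Inr u) * B (Inr u) v)"
      using c(2) that I V by (simp add: sum.Plus B_def)
    moreover have "(\<Sum>u\<in>V. c (Inr u) * B (Inr u) v) \<le> 0"
      using c(1) by (intro sum_nonpos) (auto simp: B_def)
    ultimately show ?thesis
      by simp
  qed
  with c(1) show ?thesis
    by (intro exI[of _ "\<lambda>i. c (Inl i)"]) auto
qed

text \<open>Strong duality in which only the constraints indexed by \<open>J\<close> are relaxed. A
  lower bound \<open>z\<close> stands in for the optimal value, so attainment is not at
  issue.\<close>

lemma time_shares_lp_duality:
  fixes p :: "'a \<Rightarrow> real" and a :: "'j \<Rightarrow> 'a \<Rightarrow> real"
  assumes S: "finite S" and J: "finite J"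
    and opt: "\<And>\<omega>. \<lbrakk>\<omega> \<in> time_shares S; \<forall>j\<in>J. r j \<le> (\<Sum>I\<in>S. \<omega> I * a j I)\<rbrakk>
      \<Longrightarrow> z \<le> (\<Sum>I\<in>S. \<omega> I * p I)"
  shows "\<exists>lam. (\<forall>j\<in>J. 0 \<le> lam j) \<and> (\<forall>\<omega>\<in>time_shares S.
    z \<le> (\<Sum>I\<in>S. \<omega> I * p I) + (\<Sum>j\<in>J. lam j * (r j - (\<Sum>I\<in>S. \<omega> I * a j I))))"
proof -
  \<comment> \<open>Variable \<open>None\<close> homogenises the constraints; row \<open>None\<close> bounds the total
    time share. That row also makes the implication hold when the homogenising variable is 0.\<close>
  define V where "V = insert None (Some ` S)"
  define K where "K = insert None (Some ` J)"
  define A :: "'j option \<Rightarrow> 'a option \<Rightarrow> real" where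
    "A = case_option (case_option (- 1) (\<lambda>_. 1)) (\<lambda>j. case_option (r j) (\<lambda>I. - a j I))"
  define b where "b = case_option z (\<lambda>I. - p I)"
  have V_sum: "(\<Sum>v\<in>V. f v) = f None + (\<Sum>I\<in>S. f (Some I))" for f :: "'a option \<Rightarrow> real"
    unfolding V_def using S by (subst sum.insert) (auto simp: sum.reindex)
  have K_sum: "(\<Sum>k\<in>K. f k) = f None + (\<Sum>j\<in>J. f (Some j))" for f :: "'j option \<Rightarrow> real"
    unfolding K_def using J by (subst sum.insert) (auto simp: sum.reindex)
  have "(\<Sum>v\<in>V. b v * x v) \<le> 0"
    if pos: "\<forall>v\<in>V. 0 \<le> x v" and x: "\<forall>k\<in>K. (\<Sum>v\<in>V. A k v * x v) \<le> 0" for x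
  proof -
    let ?t = "x None"
    have xI: "\<forall>I\<in>S. 0 \<le> x (Some I)" and t0: "0 \<le> ?t"
      using pos by (auto simp: V_def)
    have total: "(\<Sum>I\<in>S. x (Some I)) \<le> ?t"
      using x by (simp add: K_def A_def V_sum)
    have rows: "r j * ?t \<le> (\<Sum>I\<in>S. x (Some I) * a j I)" if "j \<in> J" for j
      using x that by (simp add: K_def A_def V_sum sum_negf mult.commute)
    have "z * ?t \<le> (\<Sum>I\<in>S. x (Some I) * p I)"
    proof (cases "?t = 0")
      case True
      then have "(\<Sum>I\<in>S. x (Some I)) = 0"
        using total xI by (intro antisym sum_nonneg) auto
      then have "\<forall>I\<in>S. x (Some I) = 0"
        using S xI by (simp add: sum_nonneg_eq_0_iff)
      with True show ?thesis
        by simp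
    next
      case False
      with t0 have t: "?t > 0"
        by simp
      \<comment> \<open>Dividing by the homogenising variable gives a feasible time share, to which
        \<open>opt\<close> applies.\<close>
      have scale: "(\<Sum>I\<in>S. x (Some I) / ?t * f I) = (\<Sum>I\<in>S. x (Some I) * f I) / ?t" for f
        by (simp add: sum_divide_distrib)
      have "z \<le> (\<Sum>I\<in>S. x (Some I) / ?t * p I)"
      proof (rule opt)
        show "(\<lambda>I. x (Some I) / ?t) \<in> time_shares S"
          using t xI total by (simp add: time_shares_def sum_divide_distrib[symmetric])
        show "\<forall>j\<in>J. r j \<le> (\<Sum>I\<in>S. x (Some I) / ?t * a j I)"
          using t rows unfolding scale by (simp add: pos_le_divide_eq)
      qed
      with t show ?thesis
        unfolding scale by (simp add: pos_le_divide_eq)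
    qed
    then show ?thesis
      by (simp add: b_def V_sum sum_negf mult.commute)
  qed
  then obtain c where c: "\<forall>k\<in>K. 0 \<le> c k" "\<forall>v\<in>V. b v \<le> (\<Sum>k\<in>K. c k * A k v)"
    using farkas_nonneg[of K V A b] S J by (auto simp: K_def V_def)
  have c0: "0 \<le> c None" and cj: "\<forall>j\<in>J. 0 \<le> c (Some j)"
    using c(1) by (auto simp: K_def)
  \<comment> \<open>Column \<open>None\<close> bounds \<open>z\<close> by the dual objective; the
    columns \<open>Some I\<close> give dual feasibility.\<close>
  have z: "z \<le> (\<Sum>j\<in>J. c (Some j) * r j) - c None"
    using c(2) by (simp add: V_def b_def A_def K_sum)
  have p: "(\<Sum>j\<in>J. c (Some j) * a j I) - c None \<le> p I" if "I \<in> S" for I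
  proof -
    have "b (Some I) \<le> (\<Sum>k\<in>K. c k * A k (Some I))"
      using c(2) that by (simp add: V_def)
    then show ?thesis
      by (simp add: b_def A_def K_sum sum_negf)
  qed
  have "z \<le> (\<Sum>I\<in>S. \<omega> I * p I)
      + (\<Sum>j\<in>J. c (Some j) * (r j - (\<Sum>I\<in>S. \<omega> I * a j I)))"
    if \<omega>: "\<omega> \<in> time_shares S" for \<omega>
  proof -
    have "(\<Sum>I\<in>S. \<omega> I * ((\<Sum>j\<in>J. c (Some j) * a j I) - c None))
        \<le> (\<Sum>I\<in>S. \<omega> I * p I)"
      using p \<omega> by (intro sum_mono mult_left_mono) (auto simp: time_shares_def)
    moreover have "(\<Sum>I\<in>S. \<omega> I * ((\<Sum>j\<in>J. c (Some j) * a j I) - c None))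
        = (\<Sum>j\<in>J. c (Some j) * (\<Sum>I\<in>S. \<omega> I * a j I)) - c None * (\<Sum>I\<in>S. \<omega> I)"
      by (simp add: right_diff_distrib sum_subtractf sum_distrib_left sum.swap[of _ J S] mult_ac)
    \<comment> \<open>The multiplier of the total share thus cancels against the
      \<open>- c None\<close> in the bound on \<open>z\<close>.\<close>
    moreover have "c None * (\<Sum>I\<in>S. \<omega> I) \<le> c None"
      using c0 \<omega> by (intro mult_left_le) (auto simp: time_shares_def)
    moreover have "(\<Sum>j\<in>J. c (Some j) * (r j - (\<Sum>I\<in>S. \<omega> I * a j I)))
        = (\<Sum>j\<in>J. c (Some j) * r j) - (\<Sum>j\<in>J. c (Some j) * (\<Sum>I\<in>S. \<omega> I * a j I))"
      by (simp add: right_diff_distrib sum_subtractf)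
    ultimately show ?thesis
      using z by linarith
  qed
  with cj show ?thesis
    by (intro exI[of _ "\<lambda>j. c (Some j)"]) blast
qed

section \<open>Finiteness of the problem and nonnegativity of powers\<close>

lemma finite_admissible_sets:
  assumes "valid_network N"
  shows "finite (admissible_sets N)"
proof -
  have "links N \<subseteq> (SIGMA i:access_points N. SIGMA m:Tx N i. SIGMA j:terminals N.
      Rx N j \<times> channels N)"
    by (auto simp: links_def)
  moreover have "finite (SIGMA i:access_points N. SIGMA m:Tx N i. SIGMA j:terminals N.
      Rx N j \<times> channels N)"
    using assms by (intro finite_SigmaI) (auto simp: valid_network_def)
  ultimately have "finite (Pow (links N))"
    by (simp add: finite_subset)
  then show ?thesis
    by (rule rev_finite_subset) (auto simp: admissible_sets_def independent_set_def)
qed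

lemma total_power_nonneg:
  assumes "valid_network N" "I \<in> admissible_sets N"
  shows "0 \<le> total_power N I"
proof -
  have "0 \<le> P_AC N I"
    using assms unfolding P_AC_def valid_network_def by (intro sum_nonneg) auto
  \<comment> \<open>Admissibility supplies an allocation, so the infimum ranges over a nonempty set
    of nonnegative reals.\<close>
  moreover have "0 \<le> P_DC N I"
    using assms unfolding P_DC_def
    by (intro cINF_greatest)
      (auto simp: admissible_sets_def illumination_allocations_def intro!: sum_nonneg)
  ultimately show ?thesis
    by (simp add: total_power_def)
qed

lemma P_illumi_min_nonneg:
  assumes "valid_network N"
  shows "0 \<le> P_illumi_min N"
  using assms total_power_nonneg[OF assms, of "{}"]
  by (auto simp: P_illumi_min_def admissible_sets_def independent_set_def valid_network_def)

lemma objective_nonneg: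
  assumes "valid_network N" "S \<subseteq> admissible_sets N" "\<omega> \<in> feasible_solutions N S"
  shows "0 \<le> objective N S \<omega>"
proof -
  have "0 \<le> (\<Sum>I\<in>S. \<omega> I * total_power N I)"
    using assms total_power_nonneg[OF assms(1)]
    by (intro sum_nonneg mult_nonneg_nonneg) (auto simp: feasible_solutions_def time_shares_def)
  then show ?thesis
    using assms P_illumi_min_nonneg[OF assms(1)]
    by (auto simp: objective_def feasible_solutions_def time_shares_def)
qed

lemma optimal_value_nonneg:
  assumes "valid_network N" "S \<subseteq> admissible_sets N" "feasible_solutions N S \<noteq> {}"
  shows "0 \<le> optimal_value N S"
  unfolding optimal_value_def using assms by (intro cINF_greatest objective_nonneg)

text \<open>Nonnegative powers bound the objective below, which makes the real infimum a genuine
  lower bound.\<close>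

lemma optimal_value_le_objective:
  assumes "valid_network N" "S \<subseteq> admissible_sets N" "\<omega> \<in> feasible_solutions N S"
  shows "optimal_value N S \<le> objective N S \<omega>"
  unfolding optimal_value_def
  using assms by (intro cINF_lower bdd_belowI2[of _ 0] objective_nonneg)

lemma optimal_value_eq_objective:
  assumes "optimal_solution N S \<omega>"
  shows "optimal_value N S = objective N S \<omega>"
  unfolding optimal_value_def
  using assms by (intro cInf_eq_minimum) (auto simp: optimal_solution_def)

section \<open>Weak and strong duality for the Lagrangian\<close>

lemma lagrangian_le_objective:
  assumes "\<omega> \<in> feasible_solutions N S" "\<forall>j\<in>terminals N. 0 \<le> lam j"
  shows "lagrangian N S lam \<omega> \<le> objective N S \<omega>"
  using assms unfolding lagrangian_def feasible_solutions_def
  by (auto intro!: sum_nonpos mult_nonneg_nonpos)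

lemma objective_eq:
  "objective N S \<omega> = (\<Sum>I\<in>S. \<omega> I * (total_power N I - P_illumi_min N)) + P_illumi_min N"
  by (simp add: objective_def right_diff_distrib left_diff_distrib sum_subtractf sum_distrib_right)

text \<open>Reduced costs are the coefficients of the weights, and the remaining terms do not depend
  on \<open>S\<close>. Enlarging \<open>S\<close> therefore only adds the terms of the new
  sets.\<close>

lemma lagrangian_eq_reduced_cost:
  "lagrangian N S lam \<omega> = (\<Sum>I\<in>S. \<omega> I * reduced_cost N lam I)
     + (\<Sum>j\<in>terminals N. lam j * requirement N j) + P_illumi_min N"
proof -
  have "(\<Sum>I\<in>S. \<omega> I * (\<Sum>j\<in>terminals N. lam j * rate N j I))
      = (\<Sum>j\<in>terminals N. lam j * (\<Sum>I\<in>S. \<omega> I * rate N j I))"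
    by (simp add: sum_distrib_left sum.swap[of _ "terminals N" S] mult_ac)
  then show ?thesis
    by (simp add: lagrangian_def objective_eq reduced_cost_def right_diff_distrib sum_subtractf)
qed

text \<open>Each weight lies in \<open>[0, 1]\<close>. The bound makes the infimum in
  \<open>dual_function\<close> a lower bound on every Lagrangian value.\<close>

lemma lagrangian_bdd_below:
  assumes "finite S"
  shows "bdd_below (lagrangian N S lam ` time_shares S)"
proof (rule bdd_belowI2)
  fix \<omega> assume \<omega>: "\<omega> \<in> time_shares S"
  have "- \<bar>reduced_cost N lam I\<bar> \<le> \<omega> I * reduced_cost N lam I" if "I \<in> S" for I
  proof -
    have "\<omega> I \<le> (\<Sum>I\<in>S. \<omega> I)"
      using \<omega> that assms by (intro member_le_sum) (auto simp: time_shares_def)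
    then have "\<bar>\<omega> I * reduced_cost N lam I\<bar> \<le> \<bar>reduced_cost N lam I\<bar>"
      using \<omega> that by (auto simp: time_shares_def abs_mult intro!: mult_left_le_one_le)
    then show ?thesis
      by linarith
  qed
  then show "(\<Sum>I\<in>S. - \<bar>reduced_cost N lam I\<bar>)
      + (\<Sum>j\<in>terminals N. lam j * requirement N j) + P_illumi_min N \<le> lagrangian N S lam \<omega>"
    by (simp only: lagrangian_eq_reduced_cost add_le_cancel_right sum_mono)
qed

lemma optimal_value_le_dual_function:
  assumes N: "valid_network N" and S: "S \<subseteq> admissible_sets N" and "optimal_dual N S lam"
  shows "optimal_value N S \<le> dual_function N S lam"
proof -
  have "finite S"
    using finite_subset[OF S finite_admissible_sets[OF N]] .
  moreover have "finite (terminals N)"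
    using N by (simp add: valid_network_def)
  \<comment> \<open>Moving the constant to the left leaves a linear objective, as the duality lemma
    requires.\<close>
  moreover have "optimal_value N S - P_illumi_min N
      \<le> (\<Sum>I\<in>S. \<omega> I * (total_power N I - P_illumi_min N))"
    if "\<omega> \<in> time_shares S" "\<forall>j\<in>terminals N. requirement N j \<le> (\<Sum>I\<in>S. \<omega> I * rate N j I)"
    for \<omega>
    using optimal_value_le_objective[OF N S, of \<omega>] that
    by (simp add: objective_eq feasible_solutions_def)
  ultimately obtain mu where mu: "\<forall>j\<in>terminals N. 0 \<le> mu j"
    "\<forall>\<omega>\<in>time_shares S. optimal_value N S - P_illumi_min N
      \<le> (\<Sum>I\<in>S. \<omega> I * (total_power N I - P_illumi_min N))
        + (\<Sum>j\<in>terminals N. mu j * (requirement N j - (\<Sum>I\<in>S. \<omega> I * rate N j I)))"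
    using time_shares_lp_duality[of S "terminals N" "requirement N" "rate N"
        "optimal_value N S - P_illumi_min N" "\<lambda>I. total_power N I - P_illumi_min N"]
    by blast
  have "(\<lambda>_. 0) \<in> time_shares S"
    by (simp add: time_shares_def)
  then have "optimal_value N S \<le> dual_function N S mu"
    unfolding dual_function_def using mu(2)
    by (intro cINF_greatest) (auto simp: lagrangian_def objective_eq algebra_simps)
  also have "\<dots> \<le> dual_function N S lam"
    using assms(3) mu(1) by (simp add: optimal_dual_def)
  finally show ?thesis .
qed

text \<open>The unobserved weight takes the place of \<open>\<kappa>\<close>, so the bound holds for
  \<open>c\<close> of either sign, and for arbitrary \<open>c\<close> once every admissible set is
  observed.\<close>

lemma column_generation_bound:
  assumes N: "valid_network N" and S: "S \<subseteq> admissible_sets N"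
    and lam: "optimal_dual N S lam"
    and \<omega>: "\<omega> \<in> feasible_solutions N (admissible_sets N)"
    and c: "\<And>I. I \<in> admissible_sets N - S \<Longrightarrow> c \<le> reduced_cost N lam I"
  shows "optimal_value N S + c * (\<Sum>I\<in>admissible_sets N - S. \<omega> I)
    \<le> objective N (admissible_sets N) \<omega>"
proof -
  let ?Q = "admissible_sets N"
  have fin: "finite ?Q"
    using N by (rule finite_admissible_sets)
  have pos: "\<forall>I\<in>?Q. 0 \<le> \<omega> I" and "(\<Sum>I\<in>?Q. \<omega> I) \<le> 1"
    using \<omega> by (auto simp: feasible_solutions_def time_shares_def)
  \<comment> \<open>Dropping nonnegative weights keeps the total at most 1, so
    \<open>\<omega>\<close> is also a time share of \<open>S\<close>.\<close>
  moreover have "(\<Sum>I\<in>S. \<omega> I) \<le> (\<Sum>I\<in>?Q. \<omega> I)"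
    using pos fin S by (intro sum_mono2) auto
  ultimately have "\<omega> \<in> time_shares S"
    using S by (auto simp: time_shares_def)
  then have "dual_function N S lam \<le> lagrangian N S lam \<omega>"
    unfolding dual_function_def
    using lagrangian_bdd_below[OF finite_subset[OF S fin]] by (intro cINF_lower)
  then have "optimal_value N S \<le> lagrangian N S lam \<omega>"
    using optimal_value_le_dual_function[OF N S lam] by linarith
  moreover have "lagrangian N ?Q lam \<omega>
      = lagrangian N S lam \<omega> + (\<Sum>I\<in>?Q - S. \<omega> I * reduced_cost N lam I)"
    using sum.subset_diff[OF S fin, of "\<lambda>I. \<omega> I * reduced_cost N lam I"]
    by (simp add: lagrangian_eq_reduced_cost)
  moreover have "c * (\<Sum>I\<in>?Q - S. \<omega> I) \<le> (\<Sum>I\<in>?Q - S. \<omega> I * reduced_cost N lam I)"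
    unfolding sum_distrib_left using pos c
    by (intro sum_mono) (simp add: mult.commute[of c] mult_left_mono)
  moreover have "lagrangian N ?Q lam \<omega> \<le> objective N ?Q \<omega>"
    using \<omega> lam by (intro lagrangian_le_objective) (auto simp: optimal_dual_def)
  ultimately show ?thesis
    by linarith
qed

section \<open>From the relative gap to the \<epsilon>-bound\<close>

theorem lemma1:
  fixes N :: "('ap, 'tx, 'ut, 'rx, 'ch, 'pos) vlc_network"
    and observed :: "('ap, 'tx, 'ut, 'rx, 'ch) link set set"
    and \<omega>_star :: "('ap, 'tx, 'ut, 'rx, 'ch) link set \<Rightarrow> real"
    and lam :: "'ut \<Rightarrow> real"
    and \<kappa> \<epsilon> z_star z_u z_l :: real
  assumes "valid_network N"
    and "observed \<subseteq> admissible_sets N"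
    and "feasible_solutions N observed \<noteq> {}"
    and "z_star = optimal_value N (admissible_sets N)"
    and "z_u = optimal_value N observed"
    and "optimal_dual N observed lam"
    and "optimal_solution N (admissible_sets N) \<omega>_star"
    and "(\<Sum>I\<in>admissible_sets N. \<omega>_star I) \<le> \<kappa>"
    and "z_l = lower_bound N observed lam \<kappa>"
    and "0 < z_l"
    and "0 \<le> \<epsilon>" and "\<epsilon> < 1"
    and "z_u / z_l \<le> 1 + \<epsilon>"
  shows "z_u \<le> (1 + \<epsilon>) * z_star"
proof -
  let ?Q = "admissible_sets N"
  let ?c = "min_reduced_cost N observed lam"
  have fin: "finite ?Q"
    using assms(1) by (rule finite_admissible_sets)
  have feas: "\<omega>_star \<in> feasible_solutions N ?Q"
    using assms(7) by (simp add: optimal_solution_def)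
  then have pos: "\<forall>I\<in>?Q. 0 \<le> \<omega>_star I"
    by (simp add: feasible_solutions_def time_shares_def)
  have z_star: "z_star = objective N ?Q \<omega>_star"
    using assms(4,7) by (simp add: optimal_value_eq_objective)
  have z_u_nonneg: "0 \<le> z_u"
    using assms(1,2,3,5) by (simp add: optimal_value_nonneg)
  let ?w = "\<Sum>I\<in>?Q - observed. \<omega>_star I"
  have w: "0 \<le> ?w" "?w \<le> \<kappa>"
  proof -
    show "0 \<le> ?w"
      using pos by (intro sum_nonneg) simp
    have "?w \<le> (\<Sum>I\<in>?Q. \<omega>_star I)"
      using pos fin by (intro sum_mono2) auto
    with assms(8) show "?w \<le> \<kappa>"
      by simp
  qed
  \<comment> \<open>If every admissible set is observed, \<open>?c\<close> is unspecified, but this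
    claim is vacuous and \<open>?w = 0\<close> leads to the first case below.\<close>
  have "?c \<le> reduced_cost N lam I" if "I \<in> ?Q - observed" for I
    unfolding min_reduced_cost_def using fin that by (intro Min_le) auto
  then have bound: "z_u + ?c * ?w \<le> z_star"
    using column_generation_bound[OF assms(1,2,6) feas] assms(5) z_star by simp
  show ?thesis
  proof (cases "?c * ?w \<ge> 0")
    case True
    with bound have "z_u \<le> z_star"
      by linarith
    moreover have "1 * z_star \<le> (1 + \<epsilon>) * z_star"
      using assms(11) calculation z_u_nonneg by (intro mult_right_mono) auto
    ultimately show ?thesis
      by linarith
  next
    case False
    \<comment> \<open>A nonpositive \<open>?c\<close> reverses \<open>?w \<le> \<kappa>\<close>, so
      replacing \<open>?w\<close> by \<open>\<kappa>\<close> only lowers the bound.\<close>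
    then have "?c \<le> 0"
      using w(1) by (meson linear mult_nonneg_nonneg)
    then have "?c * \<kappa> \<le> ?c * ?w"
      using w(2) by (rule mult_left_mono_neg[rotated])
    with bound have "z_l \<le> z_star"
      using assms(5,9) by (simp add: lower_bound_def mult.commute)
    then have "(1 + \<epsilon>) * z_l \<le> (1 + \<epsilon>) * z_star"
      using assms(11) by (intro mult_left_mono) auto
    moreover have "z_u \<le> (1 + \<epsilon>) * z_l"
      using assms(10,13) by (simp add: pos_divide_le_eq)
    ultimately show ?thesis
      by linarith
  qed
qed

end
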